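(* Let $1<p,q<\infty$ with $\frac1p+\frac1q=1$. Let $(\mathcal{M},0)$ be a pointed metric space with metric $d(\cdot,\cdot)$ and let $\mathcal{X}$ be a Banach space over $\mathbb{K}$. Let $\{f_n\}_{n=1}^\infty$ in $\operatorname{Lip}_0(\mathcal{M},\mathbb{K})$ be a pointed Lipschitz $p$-Bessel sequence for $(\mathcal{M},0)$ with bound $b>0$, and let $\{\tau_n\}_{n=1}^\infty$ in $\mathcal{X}$ be a pointed Lipschitz $q$-Bessel sequence for $\operatorname{Lip}_0(\mathcal{X},\mathbb{K})$ with bound $D>0$. If $\{\lambda_n\}_n\in c_0(\mathbb{N})$ (that is, $\lambda_n\in\mathbb{K}$ and $\lambda_n\to0$), then the multiplier $$M_{\lambda,f,\tau}:\mathcal{M}\to\mathcal{X},\qquad M_{\lambda,f,\tau}(x)=\sum_{n=1}^\infty\lambda_n f_n(x)\tau_n,$$ is a Lipschitz compact operator.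
   Context: $\mathbb{K}$ denotes $\mathbb{R}$ or $\mathbb{C}$. A pointed metric space $(\mathcal{M},0)$ is a metric space with a distinguished point denoted $0$; a Banach space $\mathcal{X}$ is regarded as a pointed metric space with its zero vector as distinguished point. For a pointed metric space $(\mathcal{M},0)$ and a Banach space $\mathcal{X}$, $\operatorname{Lip}_0(\mathcal{M},\mathcal{X})$ is the Banach space of Lipschitz maps $f:\mathcal{M}\to\mathcal{X}$ with $f(0)=0$, with norm $$\|f\|_{\operatorname{Lip}_0}=\sup_{x,y\in\mathcal{M},\,x\ne y}\frac{\|f(x)-f(y)\|}{d(x,y)}.$$ A sequence $\{f_n\}_n$ in $\operatorname{Lip}_0(\mathcal{M},\mathbb{K})$ is a pointed Lipschitz $p$-Bessel sequence for $(\mathcal{M},0)$ with bound $b>0$ if $$\Big(\sum_{n=1}^\infty|f_n(x)-f_n(y)|^p\Big)^{1/p}\le b\,d(x,y)\quad\text{for all }x,y\in\mathcal{M}.$$ A sequence $\{\tau_n\}_n$ in $\mathcal{X}$ is a pointed Lipschitz $q$-Bessel sequence for $\operatorname{Lip}_0(\mathcal{X},\mathbb{K})$ with bound $D>0$ if $$\Big(\sum_{n=1}^\infty|f(\tau_n)-g(\tau_n)|^q\Big)^{1/q}\le D\,\|f-g\|_{\operatorname{Lip}_0}\quad\text{for all }f,g\in\operatorname{Lip}_0(\mathcal{X},\mathbb{K}).$$ Under these assumptions, for every $\lambda=\{\lambda_n\}_n\in\ell^\infty(\mathbb{N})$ the series defining $M_{\lambda,f,\tau}(x)$ converges in norm for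 every $x\in\mathcal{M}$, and $M_{\lambda,f,\tau}\in\operatorname{Lip}_0(\mathcal{M},\mathcal{X})$. A map $F\in\operatorname{Lip}_0(\mathcal{M},\mathcal{X})$ is called Lipschitz compact if its Lipschitz image $$\Big\{\frac{F(x)-F(y)}{d(x,y)}:x,y\in\mathcal{M},\ x\ne y\Big\}$$ is relatively compact in $\mathcal{X}$, i.e. has compact closure in $\mathcal{X}$. *)

theory Defs
  imports "HOL-Analysis.Analysis"
begin

text \<open>The scalar field is the field of real or of complex numbers, up to an isometric field
  isomorphism.\<close>

class real_or_complex = real_normed_field +
  assumes real_or_complex:
    "(\<exists>\<phi> :: 'a \<Rightarrow> real. bij \<phi> \<and> (\<forall>x y. \<phi> (x + y) = \<phi> x + \<phi> y) \<and>
        (\<forall>x y. \<phi> (x * y) = \<phi> x * \<phi> y) \<and> (\<forall>x. norm (\<phi> x) = norm x)) \<or>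
     (\<exists>\<phi> :: 'a \<Rightarrow> complex. bij \<phi> \<and> (\<forall>x y. \<phi> (x + y) = \<phi> x + \<phi> y) \<and>
        (\<forall>x y. \<phi> (x * y) = \<phi> x * \<phi> y) \<and> (\<forall>x. norm (\<phi> x) = norm x))"

instance real :: real_or_complex
  by standard (rule disjI1, rule exI[of _ "\<lambda>x. x"], simp add: bij_id[unfolded id_def])

instance complex :: real_or_complex
  by standard (rule disjI2, rule exI[of _ "\<lambda>x. x"], simp add: bij_id[unfolded id_def])

text \<open>The class \<open>banach\<close> only provides real scalars. A Banach space over the scalar field \<open>'k\<close> is a
  real Banach space with a \<open>'k\<close>-scalar multiplication that extends the real one and for which the
  norm is absolutely homogeneous.\<close>

locale banach_space_over = vector_space smul
  for smul :: "'k::real_or_complex \<Rightarrow> 'x::banach \<Rightarrow> 'x" +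
  assumes smul_of_real: "smul (of_real r) x = r *\<^sub>R x"
    and norm_smul: "norm (smul c x) = norm c * norm x"

definition Lip0 :: "'m::metric_space \<Rightarrow> ('m \<Rightarrow> 'x::real_normed_vector) set" where
  "Lip0 base = {f. f base = 0 \<and> (\<exists>L. L-lipschitz_on UNIV f)}"

text \<open>The element 0 is inserted only so that the supremum is 0 on a one-point space; in all other
  cases it changes nothing, since the quotients are nonnegative.\<close>

definition Lip0_norm :: "('m::metric_space \<Rightarrow> 'x::real_normed_vector) \<Rightarrow> real" where
  "Lip0_norm f = Sup (insert 0 {norm (f x - f y) / dist x y | x y. x \<noteq> y})"

definition pointed_lipschitz_bessel ::
    "real \<Rightarrow> 'm::metric_space \<Rightarrow> (nat \<Rightarrow> 'm \<Rightarrow> 'k::real_or_complex) \<Rightarrow> real \<Rightarrow> bool" where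
  "pointed_lipschitz_bessel p base f b \<longleftrightarrow>
     0 < b \<and> (\<forall>n. f n \<in> Lip0 base) \<and>
     (\<forall>x y. summable (\<lambda>n. norm (f n x - f n y) powr p) \<and>
        (\<Sum>n. norm (f n x - f n y) powr p) powr (1 / p) \<le> b * dist x y)"

text \<open>The type argument fixes the scalar field in which the Lipschitz functions on \<open>'x\<close> take
  their values.\<close>

definition pointed_lipschitz_bessel_Lip0 ::
    "'k::real_or_complex itself \<Rightarrow> real \<Rightarrow> (nat \<Rightarrow> 'x::banach) \<Rightarrow> real \<Rightarrow> bool" where
  "pointed_lipschitz_bessel_Lip0 (_ :: 'k itself) q \<tau> D \<longleftrightarrow>
     0 < D \<and>
     (\<forall>f \<in> Lip0 (0::'x). \<forall>g \<in> Lip0 (0::'x).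
        summable (\<lambda>n. norm (f (\<tau> n) - g (\<tau> n) :: 'k) powr q) \<and>
        (\<Sum>n. norm (f (\<tau> n) - g (\<tau> n)) powr q) powr (1 / q) \<le> D * Lip0_norm (\<lambda>x. f x - g x))"

definition multiplier ::
    "('k::real_or_complex \<Rightarrow> 'x::banach \<Rightarrow> 'x) \<Rightarrow> (nat \<Rightarrow> 'k) \<Rightarrow> (nat \<Rightarrow> 'm \<Rightarrow> 'k) \<Rightarrow>
      (nat \<Rightarrow> 'x) \<Rightarrow> 'm \<Rightarrow> 'x" where
  "multiplier smul l f \<tau> x = (\<Sum>n. smul (l n * f n x) (\<tau> n))"

definition lipschitz_image :: "('m::metric_space \<Rightarrow> 'x::banach) \<Rightarrow> 'x set" where
  "lipschitz_image F = {(F x - F y) /\<^sub>R dist x y | x y. x \<noteq> y}"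

definition lipschitz_compact :: "'m::metric_space \<Rightarrow> ('m \<Rightarrow> 'x::banach) \<Rightarrow> bool" where
  "lipschitz_compact base F \<longleftrightarrow> F \<in> Lip0 base \<and> compact (closure (lipschitz_image F))"

end

theory Submission
  imports Defs
begin

text \<open>Testing the Bessel condition on \<open>\<tau>\<close> against the norm, itself a Lipschitz function, gives
  \<open>(\<Sum>n. \<parallel>\<tau> n\<parallel> powr q) \<le> D powr q\<close>. With the \<open>p\<close>-Bessel condition on \<open>f\<close>, Young's inequality bounds
  \<open>\<Sum>n. \<parallel>f n x - f n y\<parallel> / dist x y * \<parallel>\<tau> n\<parallel>\<close> by a constant independent of \<open>x\<close> and \<open>y\<close>, so the series
  defining the multiplier converges absolutely, and since \<open>l\<close> tends to \<open>0\<close>, the tails of the series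
  for the difference quotients are uniformly small. The heads range over sums of finitely many
  compact discs, hence the Lipschitz image is totally bounded.\<close>

section \<open>Compactness criteria: approximation by compact sets, and closed discs of
  scalars\<close>

text \<open>A finite net of an approximating compact set is also a net of \<open>S\<close>, slightly
  coarser, and of its closure. Completeness of the space then turns total boundedness into
  compactness.\<close>

lemma compact_closure_if_near_compact:
  fixes S :: "'a::complete_space set"
  assumes near: "\<And>e. e > 0 \<Longrightarrow> \<exists>K. compact K \<and> (\<forall>x\<in>S. \<exists>y\<in>K. dist y x < e)"
  shows "compact (closure S)"
  unfolding compact_eq_totally_bounded
proof (intro conjI allI impI)
  show "complete (closure S)"
    by (simp add: complete_eq_closed)
next
  fix e :: real
  assume e: "e > 0"
  \<comment> \<open>Three distances below \<open>e/4\<close> are added later: from the closure to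
    \<open>S\<close>, from \<open>S\<close> to \<open>K\<close>, and from \<open>K\<close> to its
    net.\<close>
  obtain K where K: "compact K" "\<forall>x\<in>S. \<exists>y\<in>K. dist y x < e/4"
    using near[of "e/4"] e by auto
  obtain k where k: "finite k" "K \<subseteq> (\<Union>x\<in>k. ball x (e/4))"
    using K(1) e unfolding compact_eq_totally_bounded by (metis divide_pos_pos zero_less_numeral)
  have "closure S \<subseteq> (\<Union>x\<in>k. ball x e)"
  proof
    fix x
    assume "x \<in> closure S"
    then obtain y where y: "y \<in> S" "dist y x < e/4"
      using e by (meson closure_approachable divide_pos_pos zero_less_numeral)
    obtain z where z: "z \<in> K" "dist z y < e/4"
      using K(2) y by blast
    obtain w where w: "w \<in> k" "dist w z < e/4"
      using k(2) z by auto
    have "dist w x < e"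
      using y z w e dist_triangle[of w x z] dist_triangle[of z x y] by linarith
    then show "x \<in> (\<Union>x\<in>k. ball x e)"
      using w by auto
  qed
  with k(1) show "\<exists>k. finite k \<and> closure S \<subseteq> (\<Union>x\<in>k. ball x e)"
    by blast
qed

text \<open>Additivity turns preservation of norms into preservation of distances, so the ball is
  the continuous image of a compact ball under \<open>inv \<phi>\<close>. Both alternatives of
  \<open>real_or_complex\<close> are instances.\<close>

lemma compact_cball_0_if_additive_isometry:
  fixes \<phi> :: "'a::real_normed_vector \<Rightarrow> 'b::{real_normed_vector, heine_borel}"
  assumes "bij \<phi>" and add: "\<And>x y. \<phi> (x + y) = \<phi> x + \<phi> y" and iso: "\<And>x. norm (\<phi> x) = norm x"
  shows "compact (cball (0::'a) r)"
proof -
  interpret \<phi>: additive \<phi>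
    by standard (rule add)
  have inv: "\<phi> (inv \<phi> y) = y" "inv \<phi> (\<phi> x) = x" for x y
    using \<open>bij \<phi>\<close> by (simp_all add: bij_is_surj surj_f_inv_f bij_is_inj)
  have dist: "dist (inv \<phi> x) (inv \<phi> y) = dist x y" for x y
    by (metis \<phi>.diff dist_norm inv(1) iso)
  have "continuous_on (cball 0 r) (inv \<phi>)"
    unfolding continuous_on_iff by (auto simp: dist)
  moreover have "inv \<phi> ` cball 0 r = cball 0 r"
  proof (intro equalityI subsetI)
    fix x :: 'a
    assume "x \<in> cball 0 r"
    then have "\<phi> x \<in> cball 0 r"
      by (simp add: iso)
    then show "x \<in> inv \<phi> ` cball 0 r"
      by (metis inv(2) image_eqI)
  qed (use dist[of 0] \<phi>.zero inv in \<open>auto simp: iso[symmetric]\<close>)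
  ultimately show ?thesis
    by (metis compact_cball compact_continuous_image)
qed

lemma compact_cball_0_real_or_complex:
  "compact (cball (0::'k::real_or_complex) r)"
  using real_or_complex[where 'a='k] by (blast intro: compact_cball_0_if_additive_isometry)

section \<open>Series with varying scalar coefficients and fixed vectors\<close>

context banach_space_over
begin

lemma continuous_on_smul_left: "continuous_on A (\<lambda>c. smul c v)"
proof -
  have "bounded_linear (\<lambda>c. smul c v)"
  proof
    show "smul (r *\<^sub>R c) v = r *\<^sub>R smul c v" for r c
      by (simp add: scaleR_conv_of_real flip: smul_of_real)
  qed (auto simp: scale_left_distrib norm_smul intro!: exI[of _ "norm v"])
  then show ?thesis
    by (rule linear_continuous_on)
qed

text \<open>\<open>K\<close> is the Minkowski sum of the compact discs swept out by multiples of
  \<open>v n\<close> with scalars of norm at most \<open>R\<close>. It serves all \<open>c\<close>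
  simultaneously.\<close>

lemma compact_superset_partial_sums:
  fixes N :: nat
  shows "\<exists>K. compact K \<and> (\<forall>c. (\<forall>n. norm (c n) \<le> R) \<longrightarrow> (\<Sum>n<N. smul (c n) (v n)) \<in> K)"
proof (induction N)
  case 0
  then show ?case
    by (auto intro: exI[of _ "{0}"])
next
  case (Suc N)
  then obtain K where K: "compact K"
    "\<And>c. \<forall>n. norm (c n) \<le> R \<Longrightarrow> (\<Sum>n<N. smul (c n) (v n)) \<in> K"
    by blast
  let ?L = "(\<lambda>c. smul c (v N)) ` cball 0 R"
  have "compact ?L"
    by (intro compact_continuous_image continuous_on_smul_left compact_cball_0_real_or_complex)
  with K(1) have "compact {x + y | x y. x \<in> K \<and> y \<in> ?L}"
    by (rule compact_sums)
  moreover have "(\<Sum>n<Suc N. smul (c n) (v n)) \<in> {x + y | x y. x \<in> K \<and> y \<in> ?L}"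
    if "\<forall>n. norm (c n) \<le> R" for c
    using K(2)[OF that] that by force
  ultimately show ?case
    by blast
qed

text \<open>Heads of length \<open>N\<close> lie in one compact set, and the uniformly small tails
  keep every full sum within \<open>e\<close> of it.\<close>

lemma compact_closure_series:
  assumes bounded: "\<And>c n. c \<in> A \<Longrightarrow> norm (c n) \<le> R"
    and summable: "\<And>c. c \<in> A \<Longrightarrow> summable (\<lambda>n. norm (c n) * norm (v n))"
    and tails: "\<And>e. e > 0 \<Longrightarrow> \<exists>N. \<forall>c\<in>A. (\<Sum>n. norm (c (n + N)) * norm (v (n + N))) < e"
  shows "compact (closure ((\<lambda>c. \<Sum>n. smul (c n) (v n)) ` A))"
proof (rule compact_closure_if_near_compact)
  fix e :: real
  assume "e > 0"
  then obtain N where N: "\<forall>c\<in>A. (\<Sum>n. norm (c (n + N)) * norm (v (n + N))) < e"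
    using tails by blast
  obtain K where K: "compact K"
    "\<And>c. \<forall>n. norm (c n) \<le> R \<Longrightarrow> (\<Sum>n<N. smul (c n) (v n)) \<in> K"
    using compact_superset_partial_sums[of R v N] by auto
  have "\<exists>y\<in>K. dist y (\<Sum>n. smul (c n) (v n)) < e" if "c \<in> A" for c
  proof
    show "(\<Sum>n<N. smul (c n) (v n)) \<in> K"
      using K(2) bounded[OF that] by blast
    have abs: "summable (\<lambda>n. norm (smul (c n) (v n)))"
      using summable[OF that] by (simp add: norm_smul)
    have "norm (\<Sum>n. smul (c (n + N)) (v (n + N))) \<le> (\<Sum>n. norm (smul (c (n + N)) (v (n + N))))"
      by (intro summable_norm summable_ignore_initial_segment[OF abs])
    also have "\<dots> < e"
      using N that by (simp add: norm_smul)
    finally show "dist (\<Sum>n<N. smul (c n) (v n)) (\<Sum>n. smul (c n) (v n)) < e"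
      using suminf_minus_initial_segment[OF summable_norm_cancel[OF abs], of N]
      by (simp add: dist_norm norm_minus_commute)
  qed
  with K(1) show "\<exists>K. compact K \<and> (\<forall>x\<in>(\<lambda>c. \<Sum>n. smul (c n) (v n)) ` A. \<exists>y\<in>K. dist y x < e)"
    by blast
qed

end

section \<open>Bounds drawn from the two Bessel conditions\<close>

text \<open>Young's inequality is summed term by term. The bound is coarser than Hoelder's, but it
  suffices that it depends only on the two power sums.\<close>

lemma Youngs_inequality_series:
  fixes a t :: "nat \<Rightarrow> real"
  assumes "1 < p" "1 < q" "1 / p + 1 / q = 1"
    and nonneg: "\<And>n. 0 \<le> a n" "\<And>n. 0 \<le> t n"
    and a: "summable (\<lambda>n. a n powr p)" and t: "summable (\<lambda>n. t n powr q)"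
  shows "summable (\<lambda>n. a n * t n)"
    and "(\<Sum>n. a n * t n) \<le> (\<Sum>n. a n powr p) / p + (\<Sum>n. t n powr q) / q"
proof -
  have le: "a n * t n \<le> a n powr p / p + t n powr q / q" for n
    using assms by (intro Youngs_inequality) auto
  have sum: "summable (\<lambda>n. a n powr p / p + t n powr q / q)"
    using a t by (intro summable_add summable_divide)
  show "summable (\<lambda>n. a n * t n)"
    by (rule summable_comparison_test'[OF sum]) (use le nonneg in auto)
  then have "(\<Sum>n. a n * t n) \<le> (\<Sum>n. a n powr p / p + t n powr q / q)"
    using le sum by (intro suminf_le)
  also have "\<dots> = (\<Sum>n. a n powr p) / p + (\<Sum>n. t n powr q) / q"
    using a t by (simp add: suminf_add[symmetric] summable_divide suminf_divide)
  finally show "(\<Sum>n. a n * t n) \<le> (\<Sum>n. a n powr p) / p + (\<Sum>n. t n powr q) / q" .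
qed

lemma le_powr_if_powr_inverse_le:
  fixes s r p :: real
  assumes "0 < p" "0 \<le> s" "s powr (1 / p) \<le> r"
  shows "s \<le> r powr p"
  using powr_mono2[of p "s powr (1 / p)" r] assms by (simp add: powr_powr)

text \<open>\<open>0 \<le> L\<close> accounts for the element 0 inserted into the supremum.\<close>

lemma Lip0_norm_le:
  assumes "0 \<le> L" "\<And>x y. norm (f x - f y) \<le> L * dist x y"
  shows "Lip0_norm f \<le> L"
  unfolding Lip0_norm_def using assms by (intro cSup_least) (auto simp: divide_le_eq)

lemma pointed_lipschitz_bessel_Lip0D:
  fixes f g :: "'x::banach \<Rightarrow> 'k::real_or_complex"
  assumes bessel: "pointed_lipschitz_bessel_Lip0 TYPE('k) q \<tau> D"
    and f: "f \<in> Lip0 0" and g: "g \<in> Lip0 0"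
  shows "0 < D"
    and "summable (\<lambda>n. norm (f (\<tau> n) - g (\<tau> n)) powr q)"
    and "(\<Sum>n. norm (f (\<tau> n) - g (\<tau> n)) powr q) powr (1 / q) \<le> D * Lip0_norm (\<lambda>x. f x - g x)"
proof -
  note D = bessel[unfolded pointed_lipschitz_bessel_Lip0_def]
  from D show "0 < D"
    by (rule conjunct1)
  note D' = conjunct2[OF D, THEN bspec, OF f, THEN bspec, OF g]
  from D' show "summable (\<lambda>n. norm (f (\<tau> n) - g (\<tau> n)) powr q)"
    by (rule conjunct1)
  from D' show "(\<Sum>n. norm (f (\<tau> n) - g (\<tau> n)) powr q) powr (1 / q)
      \<le> D * Lip0_norm (\<lambda>x. f x - g x)"
    by (rule conjunct2)
qed

lemma pointed_lipschitz_bessel_Lip0_norm_powr: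
  fixes \<tau> :: "nat \<Rightarrow> 'x::banach"
  assumes "0 < q" and bessel: "pointed_lipschitz_bessel_Lip0 TYPE('k::real_or_complex) q \<tau> D"
  shows "summable (\<lambda>n. norm (\<tau> n) powr q)" and "(\<Sum>n. norm (\<tau> n) powr q) \<le> D powr q"
proof -
  let ?f = "\<lambda>x::'x. of_real (norm x) :: 'k"
  have f_lip: "norm (?f x - ?f y) \<le> 1 * dist x y" for x y
    by (metis dist_norm mult_1 norm_of_real norm_triangle_ineq3 of_real_diff)
  then have "1-lipschitz_on UNIV ?f"
    by (intro lipschitz_onI) (auto simp: dist_norm)
  then have f: "?f \<in> Lip0 0"
    by (auto simp: Lip0_def)
  \<comment> \<open>Paired with the zero function, the Bessel condition speaks of \<open>?f\<close>
    itself, whose Lipschitz constant is at most 1 by the reverse triangle inequality.\<close>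
  have zero: "(\<lambda>_. 0 :: 'k) \<in> Lip0 (0::'x)"
    by (auto simp: Lip0_def intro!: exI[of _ 0] lipschitz_onI)
  note D = pointed_lipschitz_bessel_Lip0D[OF bessel f zero]
  have sum: "summable (\<lambda>n. norm (\<tau> n) powr q)"
    using D(2) by simp
  have "(\<Sum>n. norm (\<tau> n) powr q) powr (1 / q) \<le> D * Lip0_norm ?f"
    using D(3) by simp
  also have "\<dots> \<le> D * 1"
    using D(1) by (intro mult_left_mono Lip0_norm_le[OF _ f_lip]) auto
  finally have le: "(\<Sum>n. norm (\<tau> n) powr q) powr (1 / q) \<le> D"
    by simp
  from sum show "summable (\<lambda>n. norm (\<tau> n) powr q)" .
  show "(\<Sum>n. norm (\<tau> n) powr q) \<le> D powr q"
    using \<open>0 < q\<close> sum le by (intro le_powr_if_powr_inverse_le suminf_nonneg) auto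
qed

text \<open>Division by \<open>dist x y\<close> makes the Bessel bound independent of the two
  points. The termwise bound later gives a common radius for the coefficients.\<close>

lemma pointed_lipschitz_bessel_quotient:
  assumes "0 < p" and bessel: "pointed_lipschitz_bessel p base f b" and "x \<noteq> y"
  defines "a \<equiv> \<lambda>n. norm (f n x - f n y) / dist x y"
  shows "summable (\<lambda>n. a n powr p)" and "(\<Sum>n. a n powr p) \<le> b powr p" and "a n \<le> b"
proof -
  have b: "0 < b" and sum: "summable (\<lambda>n. norm (f n x - f n y) powr p)"
    and le: "(\<Sum>n. norm (f n x - f n y) powr p) powr (1 / p) \<le> b * dist x y"
    using bessel by (auto simp: pointed_lipschitz_bessel_def)
  have a_powr: "a n powr p = norm (f n x - f n y) powr p / dist x y powr p" for n
    by (simp add: a_def powr_divide)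
  show sum_a: "summable (\<lambda>n. a n powr p)"
    unfolding a_powr using sum by (rule summable_divide)
  have "(\<Sum>n. norm (f n x - f n y) powr p) \<le> (b * dist x y) powr p"
    using le sum \<open>0 < p\<close> by (intro le_powr_if_powr_inverse_le suminf_nonneg) auto
  then show le_a: "(\<Sum>n. a n powr p) \<le> b powr p"
    unfolding a_powr using sum \<open>x \<noteq> y\<close> by (simp add: suminf_divide powr_mult divide_le_eq)
  have "a n powr p \<le> (\<Sum>n. a n powr p)"
    using sum_le_suminf[OF sum_a, of "{n}"] by simp
  with le_a have "a n powr p \<le> b powr p"
    by linarith
  \<comment> \<open>If \<open>b < a n\<close>, strict monotonicity of the power would contradict the
    previous bound.\<close>
  then show "a n \<le> b"
    using powr_less_mono2[of p b "a n"] b \<open>0 < p\<close> by linarith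
qed

section \<open>The multiplier: convergence, Lipschitz bound and compactness\<close>

theorem proposition3p11:
  fixes p q b D :: real
    and base :: "'m::metric_space"
    and smul :: "'k::real_or_complex \<Rightarrow> 'x::banach \<Rightarrow> 'x"
    and f :: "nat \<Rightarrow> 'm \<Rightarrow> 'k"
    and \<tau> :: "nat \<Rightarrow> 'x"
    and l :: "nat \<Rightarrow> 'k"
  assumes "1 < p" and "1 < q" and "1 / p + 1 / q = 1"
    and "banach_space_over smul"
    and "pointed_lipschitz_bessel p base f b"
    and "pointed_lipschitz_bessel_Lip0 TYPE('k) q \<tau> D"
    and "l \<longlonglongrightarrow> 0"
  shows "(\<forall>x. summable (\<lambda>n. smul (l n * f n x) (\<tau> n))) \<and>
         lipschitz_compact base (multiplier smul l f \<tau>)"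
proof -
  interpret banach_space_over smul
    by fact
  have p: "0 < p" and q: "0 < q"
    using assms by auto
  \<comment> \<open>\<open>C\<close> is Young's bound with both Bessel bounds inserted; it does not
    depend on the points \<open>x\<close> and \<open>y\<close>.\<close>
  define C where "C = b powr p / p + D powr q / q"
  define a where "a x y n = (f n x - f n y) /\<^sub>R dist x y" for x y n
  have norm_a: "norm (a x y n) = norm (f n x - f n y) / dist x y" for x y n
    by (simp add: a_def divide_inverse mult.commute)
  note quotient = pointed_lipschitz_bessel_quotient[OF p assms(5), folded norm_a]
  note tau = pointed_lipschitz_bessel_Lip0_norm_powr[OF q assms(6)]
  have C_nonneg: "0 \<le> C"
    using p q by (simp add: C_def)
  have sum_a: "summable (\<lambda>n. norm (a x y n) * norm (\<tau> n))"
    and a_le: "(\<Sum>n. norm (a x y n) * norm (\<tau> n)) \<le> C" if "x \<noteq> y" for x y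
  proof -
    note young = Youngs_inequality_series[OF assms(1-3) norm_ge_zero norm_ge_zero
        quotient(1)[OF that] tau(1)]
    show "summable (\<lambda>n. norm (a x y n) * norm (\<tau> n))"
      by (rule young)
    have "(\<Sum>n. norm (a x y n) powr p) / p + (\<Sum>n. norm (\<tau> n) powr q) / q \<le> C"
      unfolding C_def using p q quotient(2)[OF that] tau(2)
      by (intro add_mono divide_right_mono) auto
    with young(2) show "(\<Sum>n. norm (a x y n) * norm (\<tau> n)) \<le> C"
      by linarith
  qed
  obtain L where "0 < L" and L: "\<And>n. norm (l n) \<le> L"
    using convergent_imp_Bseq[of l] assms(7) by (auto simp: convergent_def Bseq_def)
  \<comment> \<open>Used in two ways: \<open>N = 0\<close> with \<open>e = L\<close> gives
    summability and the Lipschitz bound, while large \<open>N\<close> with small \<open>e\<close>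
    gives uniformly small tails.\<close>
  have sum_la: "summable (\<lambda>n. norm (l n * a x y n) * norm (\<tau> n))"
    and tail_la: "(\<Sum>n. norm (l (n + N) * a x y (n + N)) * norm (\<tau> (n + N))) \<le> e * C"
    if "x \<noteq> y" and e: "\<And>n. norm (l (n + N)) \<le> e" for x y N e
  proof -
    let ?s = "\<lambda>n. norm (a x y n) * norm (\<tau> n)"
    have le: "norm (l (n + N) * a x y (n + N)) * norm (\<tau> (n + N)) \<le> e * ?s (n + N)" for n
      using e[of n] by (simp add: norm_mult mult.assoc mult_right_mono)
    have tail: "summable (\<lambda>n. ?s (n + N))"
      by (intro summable_ignore_initial_segment sum_a that)
    have sum_tail: "summable (\<lambda>n. norm (l (n + N) * a x y (n + N)) * norm (\<tau> (n + N)))"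
      by (rule summable_comparison_test'[OF summable_mult[OF tail, of e]]) (use le in auto)
    then show "summable (\<lambda>n. norm (l n * a x y n) * norm (\<tau> n))"
      by (rule summable_iff_shift[THEN iffD1])
    have "(\<Sum>n. ?s (n + N)) \<le> (\<Sum>n. ?s n)"
      using suminf_split_initial_segment[OF sum_a[OF that(1)], of N]
        sum_nonneg[of "{..<N}" ?s] by simp
    with a_le[OF that(1)] have "(\<Sum>n. ?s (n + N)) \<le> C"
      by linarith
    moreover have "0 \<le> e"
      using e[of 0] norm_ge_zero order_trans by blast
    moreover have "(\<Sum>n. norm (l (n + N) * a x y (n + N)) * norm (\<tau> (n + N)))
        \<le> e * (\<Sum>n. ?s (n + N))"
      using le sum_tail tail by (simp add: suminf_le summable_mult flip: suminf_mult)
    ultimately show "(\<Sum>n. norm (l (n + N) * a x y (n + N)) * norm (\<tau> (n + N))) \<le> e * C"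
      by (meson mult_left_mono order_trans)
  qed
  have abs_la: "summable (\<lambda>n. norm (smul (l n * a x y n) (\<tau> n)))" if "x \<noteq> y" for x y
    using sum_la[OF that, of 0 L] L by (simp add: norm_smul)
  have f_base: "f n base = 0" for n
    using assms(5) by (auto simp: pointed_lipschitz_bessel_def Lip0_def)
  \<comment> \<open>For \<open>x = y\<close> both sides vanish because \<open>inverse 0 = 0\<close>.
    Hence \<open>quotient_eq\<close> below holds without a side condition and can be rewritten
    inside the set comprehension of \<open>lipschitz_image\<close>.\<close>
  have smul_la: "smul (l n * a x y n) v = (smul (l n * f n x) v - smul (l n * f n y) v) /\<^sub>R dist x y"
    for n x y v
  proof -
    have "l n * a x y n = of_real (inverse (dist x y)) * (l n * f n x - l n * f n y)"
      by (simp add: a_def scaleR_conv_of_real right_diff_distrib mult.left_commute)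
    then show ?thesis
      by (simp only: scale_scale[symmetric] smul_of_real scale_left_diff_distrib)
  qed
  \<comment> \<open>Since \<open>f n base = 0\<close>, the series at \<open>x\<close> is
    \<open>dist x base\<close> times the series of the quotient between \<open>x\<close> and
    \<open>base\<close>.\<close>
  have summable_smul: "summable (\<lambda>n. smul (l n * f n x) (\<tau> n))" for x
  proof (cases "x = base")
    case False
    have "summable (\<lambda>n. dist x base *\<^sub>R smul (l n * a x base n) (\<tau> n))"
      by (rule summable_scaleR_right[OF summable_norm_cancel[OF abs_la[OF False]]])
    then show ?thesis
      using False by (simp add: smul_la f_base)
  qed (simp add: f_base)
  let ?F = "multiplier smul l f \<tau>"
  have quotient_eq: "(?F x - ?F y) /\<^sub>R dist x y = (\<Sum>n. smul (l n * a x y n) (\<tau> n))" for x y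
    unfolding multiplier_def smul_la
    by (simp add: suminf_diff summable_smul summable_diff suminf_scaleR_right)
  have norm_quotient: "norm ((?F x - ?F y) /\<^sub>R dist x y) \<le> L * C" if "x \<noteq> y" for x y
    using summable_norm[OF abs_la[OF that]] tail_la[OF that, of 0 L] L
    unfolding quotient_eq by (simp add: norm_smul)
  have "norm (?F x - ?F y) \<le> L * C * dist x y" for x y
    using norm_quotient[of x y] by (cases "x = y") (simp_all add: inverse_eq_divide divide_le_eq)
  then have "(L * C)-lipschitz_on UNIV ?F"
    using \<open>0 < L\<close> C_nonneg by (intro lipschitz_onI) (auto simp: dist_norm)
  moreover have "?F base = 0"
    by (simp add: multiplier_def f_base)
  moreover have "compact (closure (lipschitz_image ?F))"
  proof -
    \<comment> \<open>The Lipschitz image is the set of series whose coefficient sequences range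
      over \<open>?A\<close>.\<close>
    let ?A = "{\<lambda>n. l n * a x y n | x y. x \<noteq> y}"
    have "compact (closure ((\<lambda>c. \<Sum>n. smul (c n) (\<tau> n)) ` ?A))"
    proof (rule compact_closure_series)
      fix c n
      assume "c \<in> ?A"
      then obtain x y where c: "c = (\<lambda>n. l n * a x y n)" "x \<noteq> y"
        by blast
      show "norm (c n) \<le> L * b"
        unfolding c norm_mult using L \<open>0 < L\<close> quotient(3)[OF c(2)] by (intro mult_mono) auto
    next
      fix c
      assume "c \<in> ?A"
      then show "summable (\<lambda>n. norm (c n) * norm (\<tau> n))"
        using sum_la[of _ _ 0 L] L by auto
    next
      fix e :: real
      assume "e > 0"
      \<comment> \<open>The denominator \<open>C + 1\<close> is positive even if
        \<open>C = 0\<close>, and makes the tail bound \<open>e / (C + 1) * C\<close> strictly less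
        than \<open>e\<close>.\<close>
      then have "0 < e / (C + 1)"
        using C_nonneg by simp
      then obtain N where N: "\<And>n. n \<ge> N \<Longrightarrow> norm (l n) < e / (C + 1)"
        using LIMSEQ_D[OF assms(7)] by fastforce
      have "e / (C + 1) * C < e"
        using \<open>e > 0\<close> C_nonneg by (simp add: field_simps)
      moreover have "norm (l (n + N)) \<le> e / (C + 1)" for n
        using N[of "n + N"] by simp
      ultimately show "\<exists>N. \<forall>c\<in>?A. (\<Sum>n. norm (c (n + N)) * norm (\<tau> (n + N))) < e"
        using tail_la[of _ _ N "e / (C + 1)"] by (intro exI[of _ N]) fastforce
    qed
    also have "(\<lambda>c. \<Sum>n. smul (c n) (\<tau> n)) ` ?A = lipschitz_image ?F"
      unfolding lipschitz_image_def quotient_eq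
    proof (intro equalityI subsetI)
      fix z
      assume "z \<in> {\<Sum>n. smul (l n * a x y n) (\<tau> n) | x y. x \<noteq> y}"
      then obtain x y where "x \<noteq> y" "z = (\<Sum>n. smul (l n * a x y n) (\<tau> n))"
        by blast
      then show "z \<in> (\<lambda>c. \<Sum>n. smul (c n) (\<tau> n)) ` ?A"
        by (intro image_eqI[of _ _ "\<lambda>n. l n * a x y n"]) auto
    qed auto
    finally show ?thesis .
  qed
  ultimately show ?thesis
    using summable_smul by (auto simp: lipschitz_compact_def Lip0_def)
qed

end
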